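(* Let $q\geq 1$. Let $Y_1,\dots,Y_n$ be jointly distributed (not necessarily independent) nonnegative random variables, and let $X_1,\dots,X_n$ be independent random variables such that each $X_i$ has the same distribution as $Y_i$. Then $$\Big\|\sum_{i=1}^n X_i\Big\|_q \leq A_q^{1/q}\,\Big\|\sum_{i=1}^n Y_i\Big\|_q,$$ where $A_q$ is the fractional Bell number, i.e. $A_q=\mathbb{E}[P^q]=\sum_{t=1}^{\infty} t^q\frac{e^{-1}}{t!}$ for a Poisson random variable $P$ with parameter $1$. Moreover, $A_q^{1/q}$ is the optimal constant: no constant $C_q<A_q^{1/q}$ makes the inequality $\|\sum_{i=1}^n X_i\|_q\leq C_q\|\sum_{i=1}^n Y_i\|_q$ hold for all $n$ and all such $X_1,\dots,X_n$, $Y_1,\dots,Y_n$.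
   Context: Here $\|Z\|_q=(\mathbb{E}|Z|^q)^{1/q}$ denotes the $L_q$ norm of a random variable $Z$. This is the de la Peña decoupling inequality $\|\sum_i X_i\|_q\le C_q\|\sum_i Y_i\|_q$ with the constant determined exactly. *)

theory Defs
  imports "HOL-Probability.Probability"
begin

text \<open>The L_q norm (E|Z|^q)^(1/q), valued in [0,\<infinity>] so that it is defined
  for every measurable Z (it is \<infinity> exactly when E|Z|^q = \<infinity>).\<close>
definition Lq_norm :: "'a measure \<Rightarrow> real \<Rightarrow> ('a \<Rightarrow> real) \<Rightarrow> ennreal" where
  "Lq_norm M q Z =
     (let I = (\<integral>\<^sup>+ \<omega>. ennreal (\<bar>Z \<omega>\<bar> powr q) \<partial>M)
      in if I = \<infinity> then \<infinity> else ennreal (enn2real I powr (1 / q)))"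

text \<open>Fractional Bell number A_q = E[P^q] = sum_{t>=1} t^q e^{-1} / t!, P ~ Poisson(1).
  (The t = 0 term vanishes since 0 powr q = 0.)\<close>
definition frac_bell :: "real \<Rightarrow> real" where
  "frac_bell q = (\<Sum>t. real t powr q * exp (-1) / fact t)"

end

theory Submission
  imports Defs "HOL-Real_Asymp.Real_Asymp"
begin

text \<open>
  Take \<open>m\<close> independent copies of the vector \<open>Y\<close>, and for a map \<open>c\<close> from indices to copies let
  \<open>Z\<^sub>c\<close> be the sum of the \<open>i\<close>-th coordinate of copy \<open>c i\<close>. If \<open>c\<close> is injective, then \<open>Z\<^sub>c\<close> has the
  law of the sum of the \<open>X i\<close>; as \<open>m\<close> grows, almost all \<open>c\<close> are injective. For fixed values of the
  copies, convexity of \<open>x\<^sup>q\<close> and a positive-correlation argument show that the average of \<open>Z\<^sub>c\<^sup>q\<close> over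
  all \<open>c\<close> is at most the expected \<open>q\<close>-th power of the total of a random set of copies, each
  chosen independently with probability \<open>1/m\<close>. By the power mean inequality this is at most
  \<open>E K\<^sup>q\<close> times the \<open>q\<close>-th moment of the sum of the \<open>Y i\<close>, with \<open>K\<close> binomial, and
  \<open>E K\<^sup>q\<close> tends to \<open>A\<^sub>q\<close> by the Poisson limit theorem. For optimality let the \<open>Y i\<close> be the
  indicators of a partition into \<open>m\<close> events of probability \<open>1/m\<close>: the sum of the \<open>Y i\<close> is 1, while
  that of the \<open>X i\<close> is binomial.
\<close>

subsection \<open>Random positions versus random subsets\<close>

text \<open>The expectation of \<open>h J\<close> for a random subset \<open>J\<close> of \<open>A\<close> that contains each element
  independently with probability \<open>p\<close>.\<close>
definition bernoulli_sum :: "real \<Rightarrow> 'j set \<Rightarrow> ('j set \<Rightarrow> real) \<Rightarrow> real" where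
  "bernoulli_sum p A h = (\<Sum>J\<in>Pow A. p ^ card J * (1 - p) ^ card (A - J) * h J)"

text \<open>Condition on whether the random set contains \<open>j\<close>: \<open>insert j\<close>
  maps the subsets avoiding \<open>j\<close> bijectively onto those containing it.\<close>

lemma bernoulli_sum_insert:
  assumes "finite A" "j \<notin> A"
  shows "bernoulli_sum p (insert j A) h
    = p * bernoulli_sum p A (\<lambda>J. h (insert j J)) + (1 - p) * bernoulli_sum p A h"
proof -
  have inj: "inj_on (insert j) (Pow A)"
    using assms by (auto simp: inj_on_def)
  have disj: "Pow A \<inter> insert j ` Pow A = {}"
    using assms by auto
  have 1: "card (insert j J) = Suc (card J)" "insert j A - insert j J = A - J"
    "card (insert j A - J) = Suc (card (A - J))" if "J \<subseteq> A" for J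
  proof -
    have "finite J" "j \<notin> J" using assms that finite_subset by auto
    then show "card (insert j J) = Suc (card J)" "insert j A - insert j J = A - J"
      using assms by auto
    have "insert j A - J = insert j (A - J)" using \<open>j \<notin> J\<close> by auto
    then show "card (insert j A - J) = Suc (card (A - J))"
      using assms by simp
  qed
  show ?thesis
    unfolding bernoulli_sum_def Pow_insert
    by (subst sum.union_disjoint)
       (use assms disj inj in \<open>auto simp: sum.reindex sum_distrib_left 1 algebra_simps
          intro!: sum.cong\<close>)
qed

lemma bernoulli_sum_add:
  "bernoulli_sum p A (\<lambda>J. g J + h J) = bernoulli_sum p A g + bernoulli_sum p A h"
  by (simp add: bernoulli_sum_def algebra_simps sum.distrib)

lemma bernoulli_sum_diff:
  "bernoulli_sum p A (\<lambda>J. g J - h J) = bernoulli_sum p A g - bernoulli_sum p A h"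
  by (simp add: bernoulli_sum_def algebra_simps sum_subtractf)

lemma bernoulli_sum_sum:
  "bernoulli_sum p A (\<lambda>J. \<Sum>k\<in>K. g k J) = (\<Sum>k\<in>K. bernoulli_sum p A (g k))"
  unfolding bernoulli_sum_def sum_distrib_left by (rule sum.swap)

lemma bernoulli_sum_mono:
  assumes "0 \<le> p" "p \<le> 1" "\<And>J. J \<subseteq> A \<Longrightarrow> g J \<le> h J"
  shows "bernoulli_sum p A g \<le> bernoulli_sum p A h"
  unfolding bernoulli_sum_def using assms by (intro sum_mono mult_left_mono) auto

lemma bernoulli_sum_cong:
  assumes "\<And>J. J \<subseteq> A \<Longrightarrow> g J = h J"
  shows "bernoulli_sum p A g = bernoulli_sum p A h"
  unfolding bernoulli_sum_def using assms by (intro sum.cong) auto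

text \<open>Grouping subsets by size shows that the size of the random set is binomial.\<close>

lemma bernoulli_sum_card:
  assumes "finite A"
  shows "bernoulli_sum p A (\<lambda>J. g (card J))
    = (\<Sum>k\<le>card A. real (card A choose k) * p ^ k * (1 - p) ^ (card A - k) * g k)"
proof -
  have "bernoulli_sum p A (\<lambda>J. g (card J))
      = (\<Sum>k\<le>card A. \<Sum>J\<in>{J\<in>Pow A. card J = k}. p ^ card J * (1 - p) ^ card (A - J) * g (card J))"
    unfolding bernoulli_sum_def using assms
    by (intro sum.group[symmetric]) (auto intro: card_mono)
  also have "\<dots> = (\<Sum>k\<le>card A. \<Sum>J\<in>{J\<in>Pow A. card J = k}. p ^ k * (1 - p) ^ (card A - k) * g k)"
    using assms by (intro sum.cong) (auto simp: card_Diff_subset finite_subset)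
  also have "\<dots> = (\<Sum>k\<le>card A. real (card A choose k) * p ^ k * (1 - p) ^ (card A - k) * g k)"
    using n_subsets[OF assms] by (intro sum.cong) (simp_all add: Pow_def)
  finally show ?thesis .
qed

lemma bernoulli_sum_const:
  assumes "finite A"
  shows "bernoulli_sum p A (\<lambda>_. x) = x"
proof -
  have "bernoulli_sum p A (\<lambda>_. x)
      = (\<Sum>k\<le>card A. real (card A choose k) * p ^ k * (1 - p) ^ (card A - k)) * x"
    using bernoulli_sum_card[OF assms, of p "\<lambda>_. x"] by (simp add: sum_distrib_right)
  then show ?thesis using binomial_ring[of p "1 - p" "card A"] by simp
qed

text \<open>Membership of \<open>j\<close> is positively correlated with any \<open>h\<close> that grows when \<open>j\<close> is added.\<close>
lemma bernoulli_sum_member: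
  assumes "finite A" "j \<in> A" "0 \<le> p" "p \<le> 1"
    and mono: "\<And>J. J \<subseteq> A - {j} \<Longrightarrow> h J \<le> h (insert j J)"
  shows "p * bernoulli_sum p A h \<le> bernoulli_sum p A (\<lambda>J. if j \<in> J then h J else 0)"
proof -
  let ?B = "A - {j}"
  have A: "A = insert j ?B" using assms by auto
  have "bernoulli_sum p A h
      = p * bernoulli_sum p ?B (\<lambda>J. h (insert j J)) + (1 - p) * bernoulli_sum p ?B h"
    by (subst A, subst bernoulli_sum_insert) (use assms in auto)
  \<comment> \<open>Only the part where \<open>j\<close> is absent is enlarged, by
    \<open>mono\<close>; afterwards the weights \<open>p\<close> and \<open>1 - p\<close> multiply
    the same quantity.\<close>
  also have "\<dots> \<le> p * bernoulli_sum p ?B (\<lambda>J. h (insert j J))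
      + (1 - p) * bernoulli_sum p ?B (\<lambda>J. h (insert j J))"
    using assms by (intro add_left_mono mult_left_mono bernoulli_sum_mono) auto
  finally have 1: "bernoulli_sum p A h \<le> bernoulli_sum p ?B (\<lambda>J. h (insert j J))"
    by (simp add: algebra_simps)
  have "bernoulli_sum p ?B (\<lambda>J. if j \<in> J then h J else 0) = bernoulli_sum p ?B (\<lambda>_. 0)"
    by (rule bernoulli_sum_cong) auto
  then have "bernoulli_sum p A (\<lambda>J. if j \<in> J then h J else 0)
      = p * bernoulli_sum p ?B (\<lambda>J. h (insert j J))"
    by (subst A, subst bernoulli_sum_insert) (use assms in \<open>auto simp: bernoulli_sum_def\<close>)
  then show ?thesis using 1 assms by (simp add: mult_left_mono)
qed

section \<open>Increments of convex functions, and the coupling of positions with subsets\<close>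

definition increasing_increments :: "(real \<Rightarrow> real) \<Rightarrow> bool" where
  "increasing_increments f \<longleftrightarrow> (\<forall>a b z. 0 \<le> a \<longrightarrow> a \<le> b \<longrightarrow> 0 \<le> z \<longrightarrow> f (a + z) - f a \<le> f (b + z) - f b)"

lemma increasing_incrementsD:
  "increasing_increments f \<Longrightarrow> 0 \<le> a \<Longrightarrow> a \<le> b \<Longrightarrow> 0 \<le> z \<Longrightarrow> f (a + z) - f a \<le> f (b + z) - f b"
  by (auto simp: increasing_increments_def)

text \<open>Lets the coupling step move one term while the sum \<open>r\<close> of the other terms
  stays fixed; \<open>0 \<le> r\<close> keeps the base points in the half-line.\<close>

lemma increasing_increments_shift:
  assumes "increasing_increments f" "0 \<le> r"
  shows "increasing_increments (\<lambda>x. f (x + r))"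
  unfolding increasing_increments_def
proof (intro allI impI)
  fix a b z :: real
  assume "0 \<le> a" "a \<le> b" "0 \<le> z"
  then show "f (a + z + r) - f (a + r) \<le> f (b + z + r) - f (b + r)"
    using increasing_incrementsD[OF assms(1), of "a + r" "b + r" z] assms(2) by (simp add: algebra_simps)
qed

text \<open>Add the \<open>z j\<close> one after another: each increment is then taken from a base
  point of at least \<open>B\<close>, and the increments telescope.\<close>

lemma increasing_increments_sum:
  assumes f: "increasing_increments f" and "finite J" "0 \<le> B" and z: "\<And>j. j \<in> J \<Longrightarrow> 0 \<le> z j"
  shows "(\<Sum>j\<in>J. f (B + z j) - f B) \<le> f (B + (\<Sum>j\<in>J. z j)) - f B"
  using assms(2) z
proof (induction J rule: finite_induct)
  case (insert j J)
  have nn: "0 \<le> (\<Sum>j\<in>J. z j)" using insert by (intro sum_nonneg) auto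
  have "f (B + z j) - f B \<le> f (B + (\<Sum>j\<in>J. z j) + z j) - f (B + (\<Sum>j\<in>J. z j))"
    using insert nn assms by (intro increasing_incrementsD[OF f]) auto
  moreover have "(\<Sum>j\<in>J. f (B + z j) - f B) \<le> f (B + (\<Sum>j\<in>J. z j)) - f B"
    using insert by auto
  ultimately show ?case using insert by (simp add: algebra_simps)
qed simp

text \<open>Both \<open>a + z\<close> and \<open>b\<close> lie between \<open>a\<close> and
  \<open>b + z\<close>, with complementary weights \<open>t\<close> and \<open>1 - t\<close>; adding
  the two convexity inequalities gives the claim. This consequence of convexity (Wright convexity)
  is all that the coupling uses.\<close>

lemma convex_on_imp_increasing_increments:
  assumes "convex_on {0..} f"
  shows "increasing_increments f"
  unfolding increasing_increments_def
proof (intro allI impI)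
  fix a b z :: real
  assume h: "0 \<le> a" "a \<le> b" "0 \<le> z"
  show "f (a + z) - f a \<le> f (b + z) - f b"
  proof (cases "b - a + z = 0")
    case True
    then have "a = b" "z = 0" using h by linarith+
    then show ?thesis by simp
  next
    case False
    define t where "t = z / (b - a + z)"
    have d: "b - a + z > 0" using False h by auto
    have t: "0 \<le> t" "t \<le> 1" using d h by (auto simp: t_def)
    have td: "t * (b - a + z) = z" using d by (simp add: t_def)
    have 1: "(1 - t) * a + t * (b + z) = a + z" "(1 - (1 - t)) * a + (1 - t) * (b + z) = b"
      using td by (simp_all add: algebra_simps)
    have "f (a + z) \<le> (1 - t) * f a + t * f (b + z)"
      using convex_onD[OF assms t, of a "b + z"] h 1 by simp
    moreover have "f b \<le> t * f a + (1 - t) * f (b + z)"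
      using convex_onD[OF assms, of "1 - t" a "b + z"] h t 1 by simp
    ultimately show ?thesis by (simp add: algebra_simps)
  qed
qed

text \<open>One step of the coupling: a term \<open>z k\<close> at a uniformly random position \<open>k\<close> is replaced by
  \<open>z j\<close> at all \<open>j\<close> in the random set \<open>J\<close> that already carries the terms \<open>s j\<close>.\<close>
lemma random_position_le_random_subset:
  fixes s z :: "'j \<Rightarrow> real"
  assumes f: "increasing_increments f" and A: "finite A" "A \<noteq> {}"
    and s: "\<And>j. j \<in> A \<Longrightarrow> 0 \<le> s j" and z: "\<And>j. j \<in> A \<Longrightarrow> 0 \<le> z j"
    and p: "p = 1 / real (card A)"
  shows "p * (\<Sum>k\<in>A. bernoulli_sum p A (\<lambda>J. f ((\<Sum>j\<in>J. s j) + z k)))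
    \<le> bernoulli_sum p A (\<lambda>J. f (\<Sum>j\<in>J. s j + z j))"
proof -
  have cA: "card A > 0" using A by (simp add: card_gt_0_iff)
  then have p01: "0 \<le> p" "p \<le> 1" and pc: "p * real (card A) = 1" by (auto simp: p)
  let ?S = "\<lambda>J. \<Sum>j\<in>J. s j"
  let ?E = "bernoulli_sum p A"
  have S0: "0 \<le> ?S J" if "J \<subseteq> A" for J using s that by (intro sum_nonneg) auto
  \<comment> \<open>Split off the value without the extra term; since \<open>p * card A = 1\<close>,
    averaging over \<open>k\<close> leaves it unchanged.\<close>
  have "p * (\<Sum>k\<in>A. ?E (\<lambda>J. f (?S J + z k)))
      = ?E (\<lambda>J. f (?S J)) + (\<Sum>k\<in>A. p * ?E (\<lambda>J. f (?S J + z k) - f (?S J)))"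
    using pc by (simp add: bernoulli_sum_diff sum_subtractf right_diff_distrib sum_distrib_left
        mult.commute mult.assoc)
  \<comment> \<open>Adding \<open>k\<close> to \<open>J\<close> raises the base point and hence the
    increment, so by positive correlation the factor \<open>p\<close> may be replaced by the event
    that \<open>k\<close> lies in \<open>J\<close>.\<close>
  also have "\<dots> \<le> ?E (\<lambda>J. f (?S J))
      + (\<Sum>k\<in>A. ?E (\<lambda>J. if k \<in> J then f (?S J + z k) - f (?S J) else 0))"
  proof (intro add_left_mono sum_mono bernoulli_sum_member)
    fix k J assume k: "k \<in> A" and J: "J \<subseteq> A - {k}"
    have "finite J" using J A finite_subset by blast
    then have "?S (insert k J) = s k + ?S J" using J by (subst sum.insert) auto
    then show "f (?S J + z k) - f (?S J) \<le> f (?S (insert k J) + z k) - f (?S (insert k J))"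
      using k J s z S0[of J] by (intro increasing_incrementsD[OF f]) auto
  qed (use A p01 in auto)
  also have "\<dots> = ?E (\<lambda>J. f (?S J) + (\<Sum>k\<in>A. if k \<in> J then f (?S J + z k) - f (?S J) else 0))"
    by (simp add: bernoulli_sum_add bernoulli_sum_sum)
  also have "\<dots> \<le> ?E (\<lambda>J. f (\<Sum>j\<in>J. s j + z j))"
  proof (rule bernoulli_sum_mono[OF p01])
    fix J assume J: "J \<subseteq> A"
    have fJ: "finite J" using J A finite_subset by auto
    \<comment> \<open>For fixed \<open>J\<close> only the increments with \<open>k\<close> in
      \<open>J\<close> remain, and together they are at most the increment of adding all these terms
      at once.\<close>
    have "(\<Sum>k\<in>A. if k \<in> J then f (?S J + z k) - f (?S J) else 0)
        = (\<Sum>k\<in>J. f (?S J + z k) - f (?S J))"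
      using J A by (simp add: sum.inter_restrict[symmetric] Int_absorb1)
    also have "\<dots> \<le> f (?S J + (\<Sum>j\<in>J. z j)) - f (?S J)"
      using J z S0 fJ by (intro increasing_increments_sum[OF f]) auto
    finally show "f (?S J) + (\<Sum>k\<in>A. if k \<in> J then f (?S J + z k) - f (?S J) else 0)
        \<le> f (\<Sum>j\<in>J. s j + z j)"
      by (simp add: sum.distrib)
  qed
  finally show ?thesis .
qed

text \<open>Induction on \<open>n\<close>, moving the last index from its random position onto the
  random subset. The function \<open>s\<close>, arbitrary in the induction, collects the terms
  already moved.\<close>

lemma random_positions_le_random_subset:
  fixes s :: "'j \<Rightarrow> real" and y :: "nat \<Rightarrow> 'j \<Rightarrow> real"
  assumes f: "increasing_increments f" and A: "finite A" "A \<noteq> {}"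
    and p: "p = 1 / real (card A)"
    and y: "\<And>i j. i < n \<Longrightarrow> j \<in> A \<Longrightarrow> 0 \<le> y i j"
    and s: "\<And>j. j \<in> A \<Longrightarrow> 0 \<le> s j"
  shows "p ^ n * (\<Sum>c\<in>{..<n} \<rightarrow>\<^sub>E A. bernoulli_sum p A (\<lambda>J. f ((\<Sum>j\<in>J. s j) + (\<Sum>i<n. y i (c i)))))
    \<le> bernoulli_sum p A (\<lambda>J. f (\<Sum>j\<in>J. s j + (\<Sum>i<n. y i j)))"
  using y s
proof (induction n arbitrary: s)
  case (Suc n)
  have p0: "0 \<le> p" by (simp add: p)
  let ?E = "bernoulli_sum p A"
  have "p ^ Suc n * (\<Sum>c\<in>{..<Suc n} \<rightarrow>\<^sub>E A. ?E (\<lambda>J. f (sum s J + (\<Sum>i<Suc n. y i (c i)))))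
     = p ^ Suc n * (\<Sum>(k, c)\<in>A \<times> ({..<n} \<rightarrow>\<^sub>E A).
          ?E (\<lambda>J. f (sum s J + (\<Sum>i<Suc n. y i ((c(n := k)) i)))))"
    unfolding lessThan_Suc PiE_insert_eq
    by (subst sum.reindex[OF inj_combinator]) (auto intro!: sum.cong simp: case_prod_unfold)
  also have "\<dots> = p ^ Suc n * (\<Sum>c\<in>{..<n} \<rightarrow>\<^sub>E A. \<Sum>k\<in>A.
          ?E (\<lambda>J. f (sum s J + (\<Sum>i<Suc n. y i ((c(n := k)) i)))))"
    by (subst sum.cartesian_product[symmetric], subst sum.swap) simp
  also have "\<dots> = p ^ n * (\<Sum>c\<in>{..<n} \<rightarrow>\<^sub>E A. p * (\<Sum>k\<in>A.
          ?E (\<lambda>J. f (sum s J + y n k + (\<Sum>i<n. y i (c i))))))"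
    by (simp add: sum_distrib_left algebra_simps)
  \<comment> \<open>For each fixed \<open>c\<close>, the one-step coupling is applied to
    \<open>f\<close> shifted by the terms that still sit at their positions.\<close>
  also have "\<dots> \<le> p ^ n * (\<Sum>c\<in>{..<n} \<rightarrow>\<^sub>E A.
          ?E (\<lambda>J. f ((\<Sum>j\<in>J. s j + y n j) + (\<Sum>i<n. y i (c i)))))"
  proof (intro mult_left_mono sum_mono random_position_le_random_subset[OF increasing_increments_shift[OF f]])
    fix c assume c: "c \<in> {..<n} \<rightarrow>\<^sub>E A"
    show "0 \<le> (\<Sum>i<n. y i (c i))"
    proof (intro sum_nonneg Suc.prems)
      fix i assume "i \<in> {..<n}"
      then show "i < Suc n" "c i \<in> A" using c by (auto simp: PiE_iff)
    qed
  qed (use A p p0 Suc.prems in auto)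
  also have "\<dots> \<le> ?E (\<lambda>J. f (\<Sum>j\<in>J. (s j + y n j) + (\<Sum>i<n. y i j)))"
    using Suc.prems by (intro Suc.IH) auto
  also have "\<dots> = ?E (\<lambda>J. f (\<Sum>j\<in>J. s j + (\<Sum>i<Suc n. y i j)))"
    by (simp add: algebra_simps)
  finally show ?case .
qed simp

section \<open>Powers: convexity up to the endpoint 0 and the power mean inequality\<close>

lemma powr_convex_nonneg:
  assumes "1 \<le> (q::real)"
  shows "convex_on {0..} (\<lambda>x. x powr q)"
proof (rule convex_on_linorderI)
  fix t x y :: real
  assume t: "0 < t" "t < 1" and xy: "x \<in> {0..}" "y \<in> {0..}" "x < y"
  show "((1 - t) *\<^sub>R x + t *\<^sub>R y) powr q \<le> (1 - t) * x powr q + t * y powr q"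
  proof (cases "x = 0")
    \<comment> \<open>At the endpoint the claim reduces to \<open>t powr q \<le> t\<close> for
      \<open>t\<close> between 0 and 1.\<close>
    case True
    have "t powr q \<le> t powr 1" using t assms by (intro powr_mono') auto
    then have "t powr q * y powr q \<le> t * y powr q" using t by (intro mult_right_mono) auto
    then show ?thesis using True xy t by (simp add: powr_mult)
  next
    case False
    then show ?thesis using convex_onD[OF powr_convex[OF assms], of t x y] xy t by simp
  qed
qed simp

text \<open>Jensen's inequality with equal weights \<open>1 / card J\<close>, multiplied by
  \<open>card J powr q\<close>.\<close>

lemma powr_sum_le:
  assumes q: "1 \<le> (q::real)" and J: "finite J" "J \<noteq> {}" and S: "\<And>j. j \<in> J \<Longrightarrow> 0 \<le> S j"
  shows "(\<Sum>j\<in>J. S j) powr q \<le> real (card J) powr (q - 1) * (\<Sum>j\<in>J. S j powr q)"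
proof -
  let ?c = "real (card J)"
  have c: "?c > 0" using J by (simp add: card_gt_0_iff)
  have "(\<Sum>j\<in>J. (1 / ?c) *\<^sub>R S j) powr q \<le> (\<Sum>j\<in>J. (1 / ?c) * S j powr q)"
    by (rule convex_on_sum[OF _ _ powr_convex_nonneg[OF q]]) (use J S c in auto)
  then have "(1 / ?c * (\<Sum>j\<in>J. S j)) powr q \<le> (1 / ?c) * (\<Sum>j\<in>J. S j powr q)"
    by (simp only: real_scaleR_def sum_distrib_left[symmetric])
  then have "(1 / ?c) powr q * (\<Sum>j\<in>J. S j) powr q \<le> (1 / ?c) * (\<Sum>j\<in>J. S j powr q)"
    using c S by (subst (asm) powr_mult) (auto intro: sum_nonneg)
  then have "?c powr q * ((1 / ?c) powr q * (\<Sum>j\<in>J. S j) powr q)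
      \<le> ?c powr q * ((1 / ?c) * (\<Sum>j\<in>J. S j powr q))"
    by (intro mult_left_mono) auto
  moreover have "?c powr q * (1 / ?c) powr q = 1"
    using c by (simp add: powr_mult[symmetric])
  ultimately show ?thesis using c by (simp add: mult.assoc[symmetric] powr_diff)
qed

lemma increasing_increments_abs_powr:
  assumes "1 \<le> q"
  shows "increasing_increments (\<lambda>x. \<bar>x\<bar> powr q)"
  using convex_on_imp_increasing_increments[OF powr_convex_nonneg[OF assms]] by (simp add: increasing_increments_def)

text \<open>The bound for fixed values of the copies. The right side is kept as a combination of
  \<open>q\<close>-th powers that each involve a single copy \<open>j\<close>, so that it can be
  integrated term by term.\<close>

lemma random_positions_powr_le:
  fixes y :: "nat \<Rightarrow> 'j \<Rightarrow> real"
  assumes q: "1 \<le> q" and A: "finite A" "A \<noteq> {}" and p: "p = 1 / real (card A)"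
    and y: "\<And>i j. i < n \<Longrightarrow> j \<in> A \<Longrightarrow> 0 \<le> y i j"
  shows "(\<Sum>c\<in>{..<n} \<rightarrow>\<^sub>E A. \<bar>\<Sum>i<n. y i (c i)\<bar> powr q)
    \<le> (\<Sum>J\<in>Pow A. \<Sum>j\<in>J. real (card A) ^ n * (p ^ card J * (1 - p) ^ card (A - J)
        * real (card J) powr (q - 1)) * \<bar>\<Sum>i<n. y i j\<bar> powr q)"
proof -
  let ?f = "\<lambda>x. \<bar>x\<bar> powr q"
  let ?m = "real (card A)"
  have m: "?m > 0" using A by (simp add: card_gt_0_iff)
  then have p01: "0 \<le> p" "p \<le> 1" using p by auto
  have S0: "0 \<le> (\<Sum>i<n. y i j)" if "j \<in> A" for j using y that by (intro sum_nonneg) auto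
  have "p ^ n * (\<Sum>c\<in>{..<n} \<rightarrow>\<^sub>E A. ?f (\<Sum>i<n. y i (c i)))
      \<le> bernoulli_sum p A (\<lambda>J. ?f (\<Sum>j\<in>J. \<Sum>i<n. y i j))"
    \<comment> \<open>With \<open>s = 0\<close> the left side does not depend on \<open>J\<close>,
      so the expectation over \<open>J\<close> disappears there.\<close>
    using random_positions_le_random_subset[OF increasing_increments_abs_powr[OF q] A p, of n y "\<lambda>_. 0"] y A
    by (simp add: bernoulli_sum_const)
  also have "\<dots> \<le> bernoulli_sum p A (\<lambda>J. real (card J) powr (q - 1) * (\<Sum>j\<in>J. ?f (\<Sum>i<n. y i j)))"
  proof (intro bernoulli_sum_mono p01)
    fix J assume J: "J \<subseteq> A"
    have nn: "0 \<le> (\<Sum>i<n. y i j)" if "j \<in> J" for j using S0 J that by auto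
    show "?f (\<Sum>j\<in>J. \<Sum>i<n. y i j) \<le> real (card J) powr (q - 1) * (\<Sum>j\<in>J. ?f (\<Sum>i<n. y i j))"
    proof (cases "J = {}")
      case False
      have "finite J" using J A finite_subset by auto
      moreover have "\<bar>\<Sum>j\<in>J. \<Sum>i<n. y i j\<bar> = (\<Sum>j\<in>J. \<Sum>i<n. y i j)"
        by (rule abs_of_nonneg) (rule sum_nonneg[OF nn])
      ultimately show ?thesis
        using powr_sum_le[OF q _ False, of "\<lambda>j. \<Sum>i<n. y i j"] nn by simp
    qed simp
  qed
  finally have "?m ^ n * (p ^ n * (\<Sum>c\<in>{..<n} \<rightarrow>\<^sub>E A. ?f (\<Sum>i<n. y i (c i))))
      \<le> ?m ^ n * bernoulli_sum p A (\<lambda>J. real (card J) powr (q - 1) * (\<Sum>j\<in>J. ?f (\<Sum>i<n. y i j)))"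
    by (intro mult_left_mono) auto
  moreover have "?m ^ n * (p ^ n * x) = x" for x
    using m by (simp add: p power_divide)
  ultimately show ?thesis
    by (simp add: bernoulli_sum_def sum_distrib_left mult.assoc)
qed

subsection \<open>Binomial moments\<close>

text \<open>\<open>E K\<^sup>q\<close> for \<open>K\<close> binomial with parameters \<open>m\<close> and \<open>1/m\<close>.\<close>
definition binomial_moment :: "real \<Rightarrow> nat \<Rightarrow> real" where
  "binomial_moment q m = (\<Sum>k\<le>m. real (m choose k) * (1 / real m) ^ k * (1 - 1 / real m) ^ (m - k) * real k powr q)"

lemma bernoulli_sum_card_powr:
  assumes "finite A"
  shows "bernoulli_sum (1 / real (card A)) A (\<lambda>J. real (card J) powr q) = binomial_moment q (card A)"
  using bernoulli_sum_card[OF assms, of "1 / real (card A)" "\<lambda>k. real k powr q"]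
  by (simp add: binomial_moment_def)

text \<open>Write the probability as the product of the \<open>1 - i/m\<close> over
  \<open>fact k\<close>, times \<open>(1 - 1/m) ^ m / (1 - 1/m) ^ k\<close>; with \<open>k\<close>
  fixed each factor has an elementary limit.\<close>

lemma binomial_prob_tendsto_Poisson:
  "(\<lambda>m. real (m choose k) * (1 / real m) ^ k * (1 - 1 / real m) ^ (m - k))
    \<longlonglongrightarrow> exp (-1) / fact k"
proof -
  have 1: "(\<lambda>m. (\<Prod>i<k. 1 - real i / real m)) \<longlonglongrightarrow> (\<Prod>i<k. 1)"
    by (intro tendsto_prod) real_asymp
  have 2: "(\<lambda>m. (1 - 1 / real m) ^ m) \<longlonglongrightarrow> exp (-1)"
    using tendsto_exp_limit_sequentially[of "-1"] by simp
  have 3: "(\<lambda>m. (1 - 1 / real m) ^ k) \<longlonglongrightarrow> (1 - 0) ^ k"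
    by (intro tendsto_power tendsto_diff tendsto_const) real_asymp
  have 4: "(\<lambda>m. (\<Prod>i<k. 1 - real i / real m) / fact k * ((1 - 1 / real m) ^ m / (1 - 1 / real m) ^ k))
      \<longlonglongrightarrow> (\<Prod>i<k. 1) / fact k * (exp (-1) / (1 - 0) ^ k)"
    by (intro tendsto_intros 1 2 3[unfolded diff_0_right]) (auto simp: 3[simplified])
  have "eventually (\<lambda>m. (\<Prod>i<k. 1 - real i / real m) / fact k * ((1 - 1 / real m) ^ m / (1 - 1 / real m) ^ k)
      = real (m choose k) * (1 / real m) ^ k * (1 - 1 / real m) ^ (m - k)) sequentially"
    \<comment> \<open>This bound gives \<open>k \<le> m\<close> and also \<open>m > 1\<close>, so
      that division by a power of \<open>1 - 1/m\<close> is legitimate.\<close>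
    using eventually_ge_at_top[of "k + 2"]
  proof eventually_elim
    case (elim m)
    have m: "k \<le> m" "real m > 1" using elim by auto
    have "(\<Prod>i<k. 1 - real i / real m) = (\<Prod>i<k. (real m - real i) * (1 / real m))"
      using m by (intro prod.cong) (auto simp: field_simps)
    also have "\<dots> = (\<Prod>i<k. real m - real i) * (1 / real m) ^ k"
      by (subst prod.distrib) simp
    also have "(\<Prod>i<k. real m - real i) = fact k * real (m choose k)"
      by (simp add: binomial_gbinomial gbinomial_prod_rev atLeast0LessThan)
    finally have "(\<Prod>i<k. 1 - real i / real m) / fact k = real (m choose k) * (1 / real m) ^ k"
      by simp
    moreover have "(1 - 1 / real m) ^ m / (1 - 1 / real m) ^ k = (1 - 1 / real m) ^ (m - k)"
      using m by (subst power_diff) (auto simp: field_simps)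
    ultimately show ?case by simp
  qed
  from Lim_transform_eventually[OF 4 this] show ?thesis by simp
qed

text \<open>The ratio of consecutive terms tends to 0. This series is the dominating one in the
  passage to the Poisson moment.\<close>

lemma summable_powr_fact: "summable (\<lambda>k. real k powr q / fact k)"
proof -
  have "eventually (\<lambda>k. (real (Suc k) / real k) powr q / real (Suc k) < 1 / 2) sequentially"
    by real_asymp
  then have "eventually (\<lambda>k. norm (real (Suc k) powr q / fact (Suc k)) \<le> 1 / 2 * norm (real k powr q / fact k)) sequentially"
    using eventually_gt_at_top[of "0::nat"]
  proof eventually_elim
    case (elim k)
    have "real (Suc k) powr q / fact (Suc k)
        = ((real (Suc k) / real k) powr q / real (Suc k)) * (real k powr q / fact k)"
      using elim(2) by (simp add: powr_divide)
    also have "\<dots> \<le> 1 / 2 * (real k powr q / fact k)"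
      using elim(1) by (intro mult_right_mono) auto
    finally show ?case by simp
  qed
  then obtain N where N: "\<And>k. k \<ge> N \<Longrightarrow> norm (real (Suc k) powr q / fact (Suc k)) \<le> 1 / 2 * norm (real k powr q / fact k)"
    by (auto simp: eventually_sequentially)
  show ?thesis by (rule summable_ratio_test[of "1 / 2" N]) (use N in auto)
qed

text \<open>A bound uniform in \<open>m\<close>, as required for domination:
  \<open>m choose k\<close> is at most \<open>m ^ k / fact k\<close>, and the remaining power is at
  most 1.\<close>

lemma binomial_prob_le:
  assumes "m > 0" "k \<le> m"
  shows "real (m choose k) * (1 / real m) ^ k * (1 - 1 / real m) ^ (m - k) \<le> 1 / fact k"
proof -
  have "fact k * real (m choose k) \<le> real m ^ k"
    using binomial_fact_pow[of m k] by (metis mult.commute of_nat_fact of_nat_le_iff of_nat_mult of_nat_power)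
  then have "real (m choose k) * (1 / real m) ^ k \<le> 1 / fact k"
    using assms by (simp add: field_simps)
  moreover have "(1 - 1 / real m) ^ (m - k) \<le> 1"
    using assms by (intro power_le_one) auto
  ultimately show ?thesis
    using assms mult_mono[of "real (m choose k) * (1 / real m) ^ k" "1 / fact k" "(1 - 1 / real m) ^ (m - k)" 1]
    by simp
qed

text \<open>Dominated convergence for series (Tannery's theorem). The moment counts as an infinite
  series because \<open>m choose k\<close> vanishes for \<open>k > m\<close>.\<close>

lemma binomial_moment_tendsto:
  "binomial_moment q \<longlonglongrightarrow> frac_bell q"
proof -
  define a where "a = (\<lambda>k m. (real (m choose k) * (1 / real m) ^ k * (1 - 1 / real m) ^ (m - k)) * real k powr q)"
  define b where "b = (\<lambda>k. exp (-1) / fact k * real k powr q)"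
  have "eventually (\<lambda>n. summable (\<lambda>k. norm (a k n))) sequentially \<and> summable (\<lambda>n. norm (b n)) \<and>
      ((\<lambda>n. suminf (\<lambda>k. a k n)) \<longlongrightarrow> suminf b) sequentially"
  proof (rule tannerys_theorem)
    show "((\<lambda>m. a k m) \<longlonglongrightarrow> b k)" for k
      unfolding a_def b_def by (intro tendsto_mult_right binomial_prob_tendsto_Poisson)
    have *: "norm (a k m) \<le> real k powr q / fact k" if "m > 0" for k m
    proof (cases "k \<le> m")
      case True
      then show ?thesis using binomial_prob_le[OF that True] that
        mult_right_mono[OF binomial_prob_le[OF that True], of "real k powr q"]
        by (simp add: a_def abs_mult)
    qed (simp add: a_def binomial_eq_0)
    show "eventually (\<lambda>(k, m). norm (a k m) \<le> real k powr q / fact k) (at_top \<times>\<^sub>F sequentially)"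
      unfolding eventually_prod_sequentially by (intro exI[of _ 1]) (use * in auto)
  qed (auto simp: summable_powr_fact)
  moreover have "suminf (\<lambda>k. a k m) = binomial_moment q m" for m
    unfolding binomial_moment_def a_def
    by (rule suminf_finite) (auto simp: binomial_eq_0)
  moreover have "suminf b = frac_bell q"
    unfolding frac_bell_def b_def by (simp add: mult.commute)
  ultimately show ?thesis by simp
qed

text \<open>The term \<open>t = 1\<close> alone is \<open>exp (-1)\<close>. Positivity is used for
  limits of products in \<open>ennreal\<close> and for continuity of \<open>powr\<close>.\<close>

lemma frac_bell_pos: "frac_bell q > 0"
proof -
  have s: "summable (\<lambda>t. real t powr q * exp (-1) / fact t)"
    using summable_mult[OF summable_powr_fact[of q], of "exp (-1)"] by (simp add: mult.commute)
  have "(\<Sum>t\<in>{1}. real t powr q * exp (-1) / fact t) \<le> frac_bell q"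
    unfolding frac_bell_def by (rule sum_le_suminf[OF s]) auto
  then have "exp (-1) \<le> frac_bell q" by simp
  then show ?thesis by (rule less_le_trans[rotated]) simp
qed

subsection \<open>The decoupling inequality\<close>

lemma distr_PiM_componentwise:
  assumes I: "finite I" and M: "\<And>i. i \<in> I \<Longrightarrow> prob_space (M i)"
    and Y: "\<And>i. i \<in> I \<Longrightarrow> Y i \<in> measurable (M i) (L i)"
  shows "distr (PiM I M) (PiM I L) (\<lambda>\<omega>. \<lambda>i\<in>I. Y i (\<omega> i)) = PiM I (\<lambda>i. distr (M i) (L i) (Y i))"
proof -
  \<comment> \<open>Dirac measures fill the indices outside \<open>I\<close>, because
    \<open>product_prob_space\<close> wants a probability measure at every index.\<close>
  define M' where "M' = (\<lambda>i. if i \<in> I then M i else return (count_space UNIV) undefined)"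
  define D where "D = (\<lambda>i. if i \<in> I then distr (M i) (L i) (Y i) else return (count_space UNIV) undefined)"
  have pM: "prob_space (M' i)" for i using M by (auto simp: M'_def intro!: prob_space_return)
  have pD: "prob_space (D i)" for i
    using M Y by (auto simp: D_def intro!: prob_space_return prob_space.prob_space_distr)
  interpret M': product_prob_space M' by (rule product_prob_spaceI) (rule pM)
  interpret D: product_prob_space D by (rule product_prob_spaceI) (rule pD)
  have eqM: "PiM I M = PiM I M'" by (intro PiM_cong) (auto simp: M'_def)
  have eqD: "PiM I (\<lambda>i. distr (M i) (L i) (Y i)) = PiM I D" by (intro PiM_cong) (auto simp: D_def)
  have setsD: "sets (PiM I L) = sets (PiM I D)" by (intro sets_PiM_cong) (auto simp: D_def)
  have meas: "(\<lambda>\<omega>. \<lambda>i\<in>I. Y i (\<omega> i)) \<in> measurable (PiM I M) (PiM I L)"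
    by (intro measurable_restrict measurable_compose[OF _ Y] measurable_component_singleton)
  have "distr (PiM I M) (PiM I L) (\<lambda>\<omega>. \<lambda>i\<in>I. Y i (\<omega> i)) = PiM I D"
  proof (rule D.PiM_eqI[OF I])
    fix A assume A: "\<And>i. i \<in> I \<Longrightarrow> A i \<in> sets (D i)"
    then have A': "\<And>i. i \<in> I \<Longrightarrow> A i \<in> sets (L i)" by (simp add: D_def)
    have "emeasure (distr (PiM I M) (PiM I L) (\<lambda>\<omega>. \<lambda>i\<in>I. Y i (\<omega> i))) (Pi\<^sub>E I A)
      = emeasure (PiM I M) ((\<lambda>\<omega>. \<lambda>i\<in>I. Y i (\<omega> i)) -` Pi\<^sub>E I A \<inter> space (PiM I M))"
      using A' I by (intro emeasure_distr meas sets_PiM_I_finite) auto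
    also have "(\<lambda>\<omega>. \<lambda>i\<in>I. Y i (\<omega> i)) -` Pi\<^sub>E I A \<inter> space (PiM I M) = Pi\<^sub>E I (\<lambda>i. Y i -` A i \<inter> space (M i))"
      by (auto simp: space_PiM PiE_iff)
    also have "emeasure (PiM I M) \<dots> = (\<Prod>i\<in>I. emeasure (M' i) (Y i -` A i \<inter> space (M i)))"
      unfolding eqM using Y A' by (intro M'.emeasure_PiM I) (auto simp: M'_def intro: measurable_sets)
    also have "\<dots> = (\<Prod>i\<in>I. emeasure (D i) (A i))"
      using Y A' by (intro prod.cong) (auto simp: M'_def D_def emeasure_distr)
    finally show "emeasure (distr (PiM I M) (PiM I L) (\<lambda>\<omega>. \<lambda>i\<in>I. Y i (\<omega> i))) (Pi\<^sub>E I A)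
      = (\<Prod>i\<in>I. emeasure (D i) (A i))" .
  qed (simp add: setsD)
  then show ?thesis by (simp add: eqD)
qed

text \<open>An injective \<open>c\<close> selects distinct, hence independent copies: reindex the
  product, then take images in each coordinate.\<close>

lemma distr_PiM_injective_copies:
  assumes "prob_space N" and I: "finite I" and c: "inj_on c I" "c \<in> I \<rightarrow> A"
    and Y: "\<And>i. i \<in> I \<Longrightarrow> Y i \<in> borel_measurable N"
  shows "distr (PiM A (\<lambda>_. N)) (PiM I (\<lambda>_. borel)) (\<lambda>\<omega>. \<lambda>i\<in>I. Y i (\<omega> (c i)))
    = PiM I (\<lambda>i. distr N borel (Y i))"
proof -
  have 1: "(\<lambda>\<omega>. \<lambda>i\<in>I. Y i (\<omega> i)) \<in> measurable (PiM I (\<lambda>_. N)) (PiM I (\<lambda>_. borel))"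
    by (intro measurable_restrict measurable_compose[OF _ Y] measurable_component_singleton)
  have 2: "(\<lambda>\<omega>. \<lambda>i\<in>I. \<omega> (c i)) \<in> measurable (PiM A (\<lambda>_. N)) (PiM I (\<lambda>_. N))"
    using c by (intro measurable_restrict measurable_component_singleton) auto
  have "PiM I (\<lambda>i. distr N borel (Y i))
      = distr (distr (PiM A (\<lambda>_. N)) (PiM I (\<lambda>_. N)) (\<lambda>\<omega>. \<lambda>i\<in>I. \<omega> (c i))) (PiM I (\<lambda>_. borel))
          (\<lambda>\<omega>. \<lambda>i\<in>I. Y i (\<omega> i))"
    using distr_PiM_reindex[of A "\<lambda>_. N" c I] assms
    by (subst distr_PiM_componentwise[symmetric]) auto
  also have "\<dots> = distr (PiM A (\<lambda>_. N)) (PiM I (\<lambda>_. borel)) (\<lambda>\<omega>. \<lambda>i\<in>I. Y i (\<omega> (c i)))"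
    by (subst distr_distr[OF 1 2]) (auto intro!: distr_cong simp: comp_def fun_eq_iff)
  finally show ?thesis by simp
qed

lemma nn_integral_sum_indep_eq_copies:
  fixes n :: nat and X :: "nat \<Rightarrow> 'a \<Rightarrow> real" and g :: "real \<Rightarrow> ennreal"
  assumes "prob_space M" "prob_space N"
    and X: "\<And>i. i < n \<Longrightarrow> X i \<in> borel_measurable M" and Y: "\<And>i. i < n \<Longrightarrow> Y i \<in> borel_measurable N"
    and indep: "prob_space.indep_vars M (\<lambda>_. borel) X {..<n}"
    and eq: "\<And>i. i < n \<Longrightarrow> distr M borel (X i) = distr N borel (Y i)"
    and c: "inj_on c {..<n}" "c \<in> {..<n} \<rightarrow> A"
    and g: "g \<in> borel_measurable borel"
  shows "(\<integral>\<^sup>+\<omega>. g (\<Sum>i<n. Y i (\<omega> (c i))) \<partial>PiM A (\<lambda>_. N)) = (\<integral>\<^sup>+\<omega>. g (\<Sum>i<n. X i \<omega>) \<partial>M)"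
proof (cases "n = 0")
  \<comment> \<open>The product criterion for independence used below requires a nonempty index set;
    for \<open>n = 0\<close> both integrals equal \<open>g 0\<close>.\<close>
  case True
  have "prob_space (PiM A (\<lambda>_. N))" by (intro prob_space_PiM assms)
  then show ?thesis using True assms by (simp add: prob_space.emeasure_space_1)
next
  case False
  let ?L = "PiM {..<n} (\<lambda>_. borel :: real measure)"
  have "(\<lambda>x. \<Sum>i<n. x i) \<in> borel_measurable ?L"
    by (intro borel_measurable_sum measurable_component_singleton)
  then have s: "(\<lambda>x. g (\<Sum>i<n. x i)) \<in> borel_measurable ?L" using g by (rule measurable_compose)
  have "(\<integral>\<^sup>+\<omega>. g (\<Sum>i<n. X i \<omega>) \<partial>M) = (\<integral>\<^sup>+x. g (\<Sum>i<n. x i) \<partial>distr M ?L (\<lambda>\<omega>. \<lambda>i\<in>{..<n}. X i \<omega>))"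
    using X s by (subst nn_integral_distr) (auto intro!: measurable_restrict)
  also have "distr M ?L (\<lambda>\<omega>. \<lambda>i\<in>{..<n}. X i \<omega>) = PiM {..<n} (\<lambda>i. distr M borel (X i))"
    using prob_space.indep_vars_iff_distr_eq_PiM'[OF assms(1), of "{..<n}" X "\<lambda>_. borel"] X indep False
    by auto
  also have "\<dots> = PiM {..<n} (\<lambda>i. distr N borel (Y i))"
    using eq by (intro PiM_cong) auto
  also have "\<dots> = distr (PiM A (\<lambda>_. N)) ?L (\<lambda>\<omega>. \<lambda>i\<in>{..<n}. Y i (\<omega> (c i)))"
    using assms by (intro distr_PiM_injective_copies[symmetric]) auto
  also have "(\<integral>\<^sup>+x. g (\<Sum>i<n. x i) \<partial>\<dots>) = (\<integral>\<^sup>+\<omega>. g (\<Sum>i<n. Y i (\<omega> (c i))) \<partial>PiM A (\<lambda>_. N))"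
  proof (subst nn_integral_distr)
    show "(\<lambda>\<omega>. \<lambda>i\<in>{..<n}. Y i (\<omega> (c i))) \<in> measurable (PiM A (\<lambda>_. N)) ?L"
      using c by (intro measurable_restrict measurable_compose[OF _ Y] measurable_component_singleton) auto
  qed (use s in auto)
  finally show ?thesis by simp
qed

lemma nn_integral_PiM_copy:
  assumes "prob_space N" "j \<in> A" "g \<in> borel_measurable N"
  shows "(\<integral>\<^sup>+\<omega>. g (\<omega> j) \<partial>PiM A (\<lambda>_. N)) = (\<integral>\<^sup>+x. g x \<partial>N)"
proof -
  have "(\<integral>\<^sup>+x. g x \<partial>N) = (\<integral>\<^sup>+x. g x \<partial>distr (PiM A (\<lambda>_. N)) N (\<lambda>\<omega>. \<omega> j))"
    using distr_PiM_component[of A "\<lambda>_. N" j] assms by simp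
  also have "\<dots> = (\<integral>\<^sup>+\<omega>. g (\<omega> j) \<partial>PiM A (\<lambda>_. N))"
    using assms by (intro nn_integral_distr) auto
  finally show ?thesis by simp
qed

text \<open>Each injective \<open>c\<close> contributes exactly the moment of the sum of the
  \<open>X i\<close>, and every other \<open>c\<close> a nonnegative amount. The pointwise bound is
  then integrated over the copies, each of which has law \<open>N\<close>.\<close>

lemma moment_le_binomial_moment:
  fixes M :: "'a measure" and N :: "'b measure" and n :: nat
  assumes q: "1 \<le> q" and pM: "prob_space M" and pN: "prob_space N"
    and X: "\<And>i. i < n \<Longrightarrow> X i \<in> borel_measurable M" and Y: "\<And>i. i < n \<Longrightarrow> Y i \<in> borel_measurable N"
    and Y0: "\<And>i. i < n \<Longrightarrow> AE \<omega> in N. 0 \<le> Y i \<omega>"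
    and indep: "prob_space.indep_vars M (\<lambda>_. borel) X {..<n}"
    and eq: "\<And>i. i < n \<Longrightarrow> distr M borel (X i) = distr N borel (Y i)"
    and m: "0 < m"
  shows "ennreal (\<Prod>i<n. real (m - i)) * (\<integral>\<^sup>+\<omega>. ennreal (\<bar>\<Sum>i<n. X i \<omega>\<bar> powr q) \<partial>M)
    \<le> ennreal (real m ^ n * binomial_moment q m) * (\<integral>\<^sup>+\<omega>. ennreal (\<bar>\<Sum>i<n. Y i \<omega>\<bar> powr q) \<partial>N)"
proof -
  let ?A = "{..<m}"
  let ?P = "PiM ?A (\<lambda>_. N)"
  let ?p = "1 / real m"
  let ?IX = "\<integral>\<^sup>+\<omega>. ennreal (\<bar>\<Sum>i<n. X i \<omega>\<bar> powr q) \<partial>M"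
  let ?IY = "\<integral>\<^sup>+\<omega>. ennreal (\<bar>\<Sum>i<n. Y i \<omega>\<bar> powr q) \<partial>N"
  let ?C = "{..<n} \<rightarrow>\<^sub>E ?A"
  let ?D = "{c \<in> ?C. inj_on c {..<n}}"
  define w where "w = (\<lambda>J. real m ^ n * (?p ^ card J * (1 - ?p) ^ card (?A - J) * real (card J) powr (q - 1)))"
  have w0: "0 \<le> w J" for J using m by (auto simp: w_def)
  have finC: "finite ?C" by (intro finite_PiE) auto
  \<comment> \<open>For \<open>m < n\<close> there is no injection, and truncated subtraction makes
    the product 0 as well.\<close>
  have cardD: "real (card ?D) = (\<Prod>i<n. real (m - i))"
    using card_inj_on_subset_funcset[of "{..<n}" ?A "{..<n}"] by (simp add: atLeast0LessThan)
  have mS: "(\<lambda>\<omega>. \<Sum>i<n. Y i (\<omega> (c i))) \<in> borel_measurable ?P" if "c \<in> ?C" for c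
    using that by (intro borel_measurable_sum measurable_compose[OF _ Y] measurable_component_singleton) auto
  have mY: "(\<lambda>\<omega>. \<Sum>i<n. Y i \<omega>) \<in> borel_measurable N"
    using Y by (intro borel_measurable_sum) auto
  have mc: "(\<lambda>\<omega>. \<Sum>i<n. Y i (\<omega> j)) \<in> borel_measurable ?P" if "j \<in> ?A" for j
    using that by (intro borel_measurable_sum measurable_compose[OF _ Y] measurable_component_singleton) auto
  \<comment> \<open>Finitely many pairs of index and copy leave a single null set.\<close>
  have "AE \<omega> in ?P. \<forall>i\<in>{..<n}. \<forall>j\<in>?A. 0 \<le> Y i (\<omega> j)"
    by (intro AE_finite_allI AE_PiM_component pN Y0) auto
  then have ae: "AE \<omega> in ?P. (\<Sum>c\<in>?C. ennreal (\<bar>\<Sum>i<n. Y i (\<omega> (c i))\<bar> powr q))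
      \<le> (\<Sum>J\<in>Pow ?A. \<Sum>j\<in>J. ennreal (w J) * ennreal (\<bar>\<Sum>i<n. Y i (\<omega> j)\<bar> powr q))"
  proof eventually_elim
    case (elim \<omega>)
    have "(\<Sum>c\<in>?C. \<bar>\<Sum>i<n. Y i (\<omega> (c i))\<bar> powr q)
      \<le> (\<Sum>J\<in>Pow ?A. \<Sum>j\<in>J. w J * \<bar>\<Sum>i<n. Y i (\<omega> j)\<bar> powr q)"
      using random_positions_powr_le[OF q, of ?A ?p n "\<lambda>i j. Y i (\<omega> j)"] elim m
      by (auto simp: w_def)
    then show ?case
      by (simp add: sum_ennreal sum_nonneg w0 ennreal_mult[symmetric] ennreal_leI)
  qed
  have "ennreal (\<Prod>i<n. real (m - i)) * ?IX
      = (\<Sum>c\<in>?D. \<integral>\<^sup>+\<omega>. ennreal (\<bar>\<Sum>i<n. Y i (\<omega> (c i))\<bar> powr q) \<partial>?P)"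
    using nn_integral_sum_indep_eq_copies[OF pM pN X Y indep eq,
        where A = ?A and g = "\<lambda>x. ennreal (\<bar>x\<bar> powr q)"]
    by (simp add: cardD[symmetric] ennreal_of_nat_eq_real_of_nat PiE_def)
  also have "\<dots> \<le> (\<Sum>c\<in>?C. \<integral>\<^sup>+\<omega>. ennreal (\<bar>\<Sum>i<n. Y i (\<omega> (c i))\<bar> powr q) \<partial>?P)"
    using finC by (intro sum_mono2) auto
  also have "\<dots> = (\<integral>\<^sup>+\<omega>. (\<Sum>c\<in>?C. ennreal (\<bar>\<Sum>i<n. Y i (\<omega> (c i))\<bar> powr q)) \<partial>?P)"
    using mS by (intro nn_integral_sum[symmetric]) auto
  also have "\<dots> \<le> (\<integral>\<^sup>+\<omega>. (\<Sum>J\<in>Pow ?A. \<Sum>j\<in>J. ennreal (w J) * ennreal (\<bar>\<Sum>i<n. Y i (\<omega> j)\<bar> powr q)) \<partial>?P)"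
    by (rule nn_integral_mono_AE[OF ae])
  also have "\<dots> = (\<Sum>J\<in>Pow ?A. \<Sum>j\<in>J. \<integral>\<^sup>+\<omega>. ennreal (w J) * ennreal (\<bar>\<Sum>i<n. Y i (\<omega> j)\<bar> powr q) \<partial>?P)"
    using mc by (subst nn_integral_sum, force intro!: borel_measurable_sum)
      (intro sum.cong refl nn_integral_sum, force)
  also have "\<dots> = (\<Sum>J\<in>Pow ?A. \<Sum>j\<in>J. ennreal (w J) * ?IY)"
  proof (intro sum.cong refl)
    fix J j assume "J \<in> Pow ?A" "j \<in> J"
    then have j: "j \<in> ?A" by auto
    show "(\<integral>\<^sup>+\<omega>. ennreal (w J) * ennreal (\<bar>\<Sum>i<n. Y i (\<omega> j)\<bar> powr q) \<partial>?P) = ennreal (w J) * ?IY"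
      using mc[OF j] mY nn_integral_PiM_copy[OF pN j, of "\<lambda>x. ennreal (\<bar>\<Sum>i<n. Y i x\<bar> powr q)"]
      by (subst nn_integral_cmult) auto
  qed
  also have "\<dots> = ennreal (\<Sum>J\<in>Pow ?A. real (card J) * w J) * ?IY"
    by (simp add: sum_ennreal[symmetric] w0 sum_distrib_right ennreal_mult ennreal_of_nat_eq_real_of_nat
        mult.assoc)
  also have "(\<Sum>J\<in>Pow ?A. real (card J) * w J) = real m ^ n * binomial_moment q m"
  proof -
    have "(\<Sum>J\<in>Pow ?A. real (card J) * w J)
        = (\<Sum>J\<in>Pow ?A. real m ^ n * (?p ^ card J * (1 - ?p) ^ card (?A - J) * real (card J) powr q))"
    proof (intro sum.cong refl)
      fix J :: "nat set"
      \<comment> \<open>The number of copies in \<open>J\<close> supplies the factor missing from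
        the power mean weight. For empty \<open>J\<close> both sides are 0, since
        \<open>0 powr x\<close> is 0.\<close>
      have "real (card J) * real (card J) powr (q - 1) = real (card J) powr q"
        by (cases "card J = 0") (auto simp: powr_diff)
      then show "real (card J) * w J
          = real m ^ n * (?p ^ card J * (1 - ?p) ^ card (?A - J) * real (card J) powr q)"
        by (simp add: w_def algebra_simps)
    qed
    also have "\<dots> = real m ^ n * bernoulli_sum ?p ?A (\<lambda>J. real (card J) powr q)"
      by (simp add: bernoulli_sum_def sum_distrib_left)
    finally show ?thesis using bernoulli_sum_card_powr[of ?A q] by simp
  qed
  finally show ?thesis .
qed

text \<open>Divide the bound for \<open>m\<close> copies by \<open>m ^ n\<close> and let
  \<open>m\<close> grow: the proportion \<open>a m\<close> of injective maps tends to 1.\<close>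

lemma moment_decoupling:
  fixes M :: "'a measure" and N :: "'b measure" and n :: nat
  assumes q: "1 \<le> q" and pM: "prob_space M" and pN: "prob_space N"
    and X: "\<And>i. i < n \<Longrightarrow> X i \<in> borel_measurable M" and Y: "\<And>i. i < n \<Longrightarrow> Y i \<in> borel_measurable N"
    and Y0: "\<And>i. i < n \<Longrightarrow> AE \<omega> in N. 0 \<le> Y i \<omega>"
    and indep: "prob_space.indep_vars M (\<lambda>_. borel) X {..<n}"
    and eq: "\<And>i. i < n \<Longrightarrow> distr M borel (X i) = distr N borel (Y i)"
  shows "(\<integral>\<^sup>+\<omega>. ennreal (\<bar>\<Sum>i<n. X i \<omega>\<bar> powr q) \<partial>M)
    \<le> ennreal (frac_bell q) * (\<integral>\<^sup>+\<omega>. ennreal (\<bar>\<Sum>i<n. Y i \<omega>\<bar> powr q) \<partial>N)"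
    (is "?IX \<le> _ * ?IY")
proof -
  define a where "a = (\<lambda>m. \<Prod>i<n. real (m - i) / real m)"
  have "a \<longlonglongrightarrow> (\<Prod>i<n. 1)"
    unfolding a_def
  proof (intro tendsto_prod)
    fix i
    have 1: "(\<lambda>m. (real m - real i) / real m) \<longlonglongrightarrow> 1" by real_asymp
    show "(\<lambda>m. real (m - i) / real m) \<longlonglongrightarrow> 1"
      by (rule Lim_transform_eventually[OF 1])
         (use eventually_ge_at_top[of i] in eventually_elim, simp add: of_nat_diff)
  qed
  then have "(\<lambda>m. ennreal (a m)) \<longlonglongrightarrow> ennreal 1" by (intro tendsto_ennrealI) simp
  \<comment> \<open>Here and in \<open>lim2\<close> the constants have positive finite limits, so
    the products converge even if a moment is infinite.\<close>
  then have lim1: "(\<lambda>m. ennreal (a m) * ?IX) \<longlonglongrightarrow> ennreal 1 * ?IX"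
    by (intro tendsto_mult_ennreal tendsto_const) auto
  have "(\<lambda>m. ennreal (binomial_moment q m)) \<longlonglongrightarrow> ennreal (frac_bell q)"
    by (intro tendsto_ennrealI binomial_moment_tendsto)
  then have lim2: "(\<lambda>m. ennreal (binomial_moment q m) * ?IY) \<longlonglongrightarrow> ennreal (frac_bell q) * ?IY"
    using frac_bell_pos[of q] by (intro tendsto_mult_ennreal tendsto_const) auto
  have "ennreal (a m) * ?IX \<le> ennreal (binomial_moment q m) * ?IY" if m: "m > 0" for m
  proof -
    let ?s = "ennreal (1 / real m ^ n)"
    have am: "a m = 1 / real m ^ n * (\<Prod>i<n. real (m - i))"
      by (simp add: a_def prod_dividef)
    have "ennreal (a m) * ?IX = ?s * (ennreal (\<Prod>i<n. real (m - i)) * ?IX)"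
      unfolding am by (subst ennreal_mult) (auto simp: mult.assoc intro: prod_nonneg)
    also have "\<dots> \<le> ?s * (ennreal (real m ^ n * binomial_moment q m) * ?IY)"
      by (intro mult_left_mono moment_le_binomial_moment assms m) auto
    also have "\<dots> = ennreal (1 / real m ^ n * (real m ^ n * binomial_moment q m)) * ?IY"
      using m by (subst ennreal_mult'') (auto simp: mult.assoc binomial_moment_def intro!: sum_nonneg mult_nonneg_nonneg)
    also have "1 / real m ^ n * (real m ^ n * binomial_moment q m) = binomial_moment q m"
      using m by simp
    finally show ?thesis .
  qed
  then have "eventually (\<lambda>m. ennreal (a m) * ?IX \<le> ennreal (binomial_moment q m) * ?IY) sequentially"
    by (intro eventually_mono[OF eventually_gt_at_top[of 0]])
  from tendsto_le[OF _ lim2 lim1 this] show ?thesis by simp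
qed

section \<open>From moments to norms\<close>

lemma Lq_norm_le:
  assumes q: "1 \<le> q" and A: "0 < A"
    and le: "(\<integral>\<^sup>+\<omega>. ennreal (\<bar>Z \<omega>\<bar> powr q) \<partial>M) \<le> ennreal A * (\<integral>\<^sup>+\<omega>. ennreal (\<bar>W \<omega>\<bar> powr q) \<partial>N)"
  shows "Lq_norm M q Z \<le> ennreal (A powr (1 / q)) * Lq_norm N q W"
proof -
  define I where "I = (\<integral>\<^sup>+\<omega>. ennreal (\<bar>Z \<omega>\<bar> powr q) \<partial>M)"
  define K where "K = (\<integral>\<^sup>+\<omega>. ennreal (\<bar>W \<omega>\<bar> powr q) \<partial>N)"
  have norms: "Lq_norm M q Z = (if I = \<infinity> then \<infinity> else ennreal (enn2real I powr (1 / q)))"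
    "Lq_norm N q W = (if K = \<infinity> then \<infinity> else ennreal (enn2real K powr (1 / q)))"
    by (simp_all add: Lq_norm_def I_def K_def)
  have IK: "I \<le> ennreal A * K" using le by (simp add: I_def K_def)
  show ?thesis
  proof (cases "K = \<infinity>")
    \<comment> \<open>The constant is positive, so the right side is infinite.\<close>
    case True
    then show ?thesis using A by (simp add: norms ennreal_mult_top)
  next
    case False
    then have fin: "ennreal A * K < top" by (simp add: ennreal_mult_less_top less_top)
    then have I: "I < top" using IK by (rule le_less_trans[rotated])
    have "enn2real I \<le> enn2real (ennreal A * K)" by (rule enn2real_mono[OF IK fin])
    also have "\<dots> = A * enn2real K" using A by (simp add: enn2real_mult)
    finally have "enn2real I powr (1 / q) \<le> (A * enn2real K) powr (1 / q)"
      using q by (intro powr_mono2) auto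
    also have "\<dots> = A powr (1 / q) * enn2real K powr (1 / q)"
      using A by (simp add: powr_mult)
    finally have "enn2real I powr (1 / q) \<le> A powr (1 / q) * enn2real K powr (1 / q)" .
    moreover have "I \<noteq> \<infinity>" using I by auto
    ultimately show ?thesis
      using False by (simp add: norms ennreal_mult[symmetric] ennreal_leI)
  qed
qed

subsection \<open>Optimality\<close>

text \<open>Under the image measure the \<open>X i\<close> have the joint and marginal laws of the
  \<open>Z i\<close>, and independence says that the joint law is the product of the marginals. This
  carries independence over to an encoded space.\<close>

lemma (in prob_space) indep_vars_distr_AE:
  assumes I: "I \<noteq> {}" and T: "T \<in> measurable M L"
    and X: "\<And>i. i \<in> I \<Longrightarrow> X i \<in> measurable L (K i)"
    and Z: "\<And>i. i \<in> I \<Longrightarrow> Z i \<in> measurable M (K i)"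
    and ae: "AE \<omega> in M. \<forall>i\<in>I. X i (T \<omega>) = Z i \<omega>"
    and indep: "indep_vars K Z I"
  shows "prob_space.indep_vars (distr M L T) K X I"
proof -
  interpret D: prob_space "distr M L T" by (rule prob_space_distr[OF T])
  have XT: "(\<lambda>\<omega>. X i (T \<omega>)) \<in> measurable M (K i)" if "i \<in> I" for i
    using measurable_compose[OF T X[OF that]] .
  have "distr (distr M L T) (PiM I K) (\<lambda>x. \<lambda>i\<in>I. X i x) = distr M (PiM I K) (\<lambda>\<omega>. \<lambda>i\<in>I. X i (T \<omega>))"
    by (subst distr_distr) (use T X in \<open>auto intro!: measurable_restrict simp: comp_def\<close>)
  also have "\<dots> = distr M (PiM I K) (\<lambda>\<omega>. \<lambda>i\<in>I. Z i \<omega>)"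
    using XT Z ae by (intro distr_cong_AE) (auto intro!: measurable_restrict elim!: eventually_mono)
  also have "\<dots> = PiM I (\<lambda>i. distr M (K i) (Z i))"
    using indep_vars_iff_distr_eq_PiM'[OF I Z] indep by simp
  also have "\<dots> = PiM I (\<lambda>i. distr (distr M L T) (K i) (X i))"
  proof (rule PiM_cong[OF refl])
    fix i assume i: "i \<in> I"
    have "distr (distr M L T) (K i) (X i) = distr M (K i) (\<lambda>\<omega>. X i (T \<omega>))"
      by (subst distr_distr) (use T X i in \<open>auto simp: comp_def\<close>)
    also have "\<dots> = distr M (K i) (Z i)"
      using XT[OF i] Z[OF i] ae i by (intro distr_cong_AE) (auto elim!: eventually_mono)
    finally show "distr M (K i) (Z i) = distr (distr M L T) (K i) (X i)" ..
  qed
  finally show ?thesis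
    using D.indep_vars_iff_distr_eq_PiM'[OF I, of X K] X by simp
qed

section \<open>Bernoulli and binomial laws for the extremal example\<close>

lemma pmf_bool_eqI:
  assumes "pmf p True = pmf r True"
  shows "p = (r :: bool pmf)"
proof (rule pmf_eqI)
  fix b show "pmf p b = pmf r b"
    using assms pmf_False_conv_True[of p] pmf_False_conv_True[of r] by (cases b) auto
qed

lemma map_pmf_of_set_eq_bernoulli:
  assumes "finite A" "a \<in> A"
  shows "map_pmf (\<lambda>x. x = a) (pmf_of_set A) = bernoulli_pmf (1 / real (card A))"
proof (rule pmf_bool_eqI)
  have ne: "A \<noteq> {}" using assms by auto
  have "pmf (map_pmf (\<lambda>x. x = a) (pmf_of_set A)) True = measure (pmf_of_set A) {a}"
    by (simp add: pmf_map vimage_def)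
  also have "\<dots> = 1 / real (card A)"
    using assms ne by (simp add: measure_pmf_of_set)
  finally show "pmf (map_pmf (\<lambda>x. x = a) (pmf_of_set A)) True
      = pmf (bernoulli_pmf (1 / real (card A))) True"
    using assms ne by (simp add: card_gt_0_iff Suc_le_eq)
qed

lemma distr_measure_pmf_compose:
  "distr (measure_pmf p) borel (\<lambda>x. g (b x)) = distr (measure_pmf (map_pmf b p)) borel g"
  by (simp add: map_pmf_rep_eq distr_distr comp_def)

lemma nn_integral_binomial_powr:
  assumes "m > 0"
  shows "(\<integral>\<^sup>+k. ennreal (real k powr q) \<partial>binomial_pmf m (1 / real m)) = ennreal (binomial_moment q m)"
proof -
  have "(\<integral>\<^sup>+k. ennreal (real k powr q) \<partial>binomial_pmf m (1 / real m))
      = (\<Sum>k\<le>m. ennreal (real k powr q) * ennreal (pmf (binomial_pmf m (1 / real m)) k))"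
    using assms by (intro nn_integral_measure_pmf_support) (auto simp: set_pmf_binomial_eq split: if_splits)
  also have "\<dots> = ennreal (\<Sum>k\<le>m. real k powr q * pmf (binomial_pmf m (1 / real m)) k)"
    by (simp add: ennreal_mult[symmetric] sum_ennreal)
  also have "(\<Sum>k\<le>m. real k powr q * pmf (binomial_pmf m (1 / real m)) k) = binomial_moment q m"
    using assms by (simp add: binomial_moment_def mult_ac)
  finally show ?thesis .
qed

text \<open>Both measures must live on the reals. Under \<open>N\<close> a uniform point of
  \<open>0, ..., m - 1\<close> is drawn, and \<open>Y i\<close> indicates that it is
  \<open>i\<close>; \<open>X i\<close> reads the \<open>i\<close>-th of \<open>m\<close> independent
  Bernoulli trials, whose outcome is encoded as a real number.\<close>

lemma partition_indicators_example:
  assumes m: "m > 0"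
  obtains M N :: "real measure" and X Y :: "nat \<Rightarrow> real \<Rightarrow> real" where
    "prob_space M" "prob_space N"
    "\<And>i. i < m \<Longrightarrow> X i \<in> borel_measurable M" "\<And>i. i < m \<Longrightarrow> Y i \<in> borel_measurable N"
    "\<And>i. i < m \<Longrightarrow> AE \<omega> in N. 0 \<le> Y i \<omega>"
    "prob_space.indep_vars M (\<lambda>_. borel) X {..<m}"
    "\<And>i. i < m \<Longrightarrow> distr M borel (X i) = distr N borel (Y i)"
    "Lq_norm M q (\<lambda>\<omega>. \<Sum>i<m. X i \<omega>) = ennreal (binomial_moment q m powr (1 / q))"
    "Lq_norm N q (\<lambda>\<omega>. \<Sum>i<m. Y i \<omega>) = 1"
proof -
  let ?p = "1 / real m"
  define P :: "(nat \<Rightarrow> bool) pmf" where "P = Pi_pmf {..<m} False (\<lambda>_. bernoulli_pmf ?p)"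
  \<comment> \<open>The support of \<open>P\<close> is countable, so numbering its elements embeds
    it into the reals.\<close>
  define e :: "(nat \<Rightarrow> bool) \<Rightarrow> real" where "e = (\<lambda>f. real (to_nat_on (set_pmf P) f))"
  have inj: "inj_on e (set_pmf P)"
    using inj_on_to_nat_on[OF countable_set_pmf[of P]] by (auto simp: e_def inj_on_def)
  \<comment> \<open>The decoding is arbitrary outside the image of the support, which is a null set
    for \<open>M\<close>.\<close>
  define d where "d = inv_into (set_pmf P) e"
  have d: "d (e f) = f" if "f \<in> set_pmf P" for f
    using inv_into_f_f[OF inj that] by (simp add: d_def)
  define M where "M = measure_pmf (map_pmf e P)"
  define A where "A = real ` {..<m}"
  have A: "finite A" "A \<noteq> {}" "card A = m"
    using m by (auto simp: A_def card_image)
  define N where "N = measure_pmf (pmf_of_set A)"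
  define X :: "nat \<Rightarrow> real \<Rightarrow> real" where "X = (\<lambda>i r. of_bool (d r i))"
  define Y :: "nat \<Rightarrow> real \<Rightarrow> real" where "Y = (\<lambda>i r. of_bool (r = real i))"
  show ?thesis
  proof
    show "prob_space M" "prob_space N" by (simp_all add: M_def N_def measure_pmf.prob_space_axioms)
    show "X i \<in> borel_measurable M" "Y i \<in> borel_measurable N" for i by (simp_all add: M_def N_def)
    show "AE \<omega> in N. 0 \<le> Y i \<omega>" for i by (simp add: Y_def)
    show "prob_space.indep_vars M (\<lambda>_. borel) X {..<m}"
      unfolding M_def map_pmf_rep_eq
    proof (rule prob_space.indep_vars_distr_AE[OF prob_space_measure_pmf, where Z = "\<lambda>i f. of_bool (f i)"])
      show "AE f in P. \<forall>i\<in>{..<m}. X i (e f) = of_bool (f i)"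
        by (auto simp: AE_measure_pmf_iff X_def d)
      show "prob_space.indep_vars P (\<lambda>_. borel) (\<lambda>i f. of_bool (f i)) {..<m}"
        by (rule prob_space.indep_vars_compose2[OF prob_space_measure_pmf, where X = "\<lambda>i f. f i" and M' = "\<lambda>_. count_space UNIV"])
           (auto simp: P_def intro!: indep_vars_Pi_pmf)
    qed (use m in auto)
    show "distr M borel (X i) = distr N borel (Y i)" if i: "i < m" for i
    proof -
      have "map_pmf (\<lambda>r. d r i) (map_pmf e P) = map_pmf (\<lambda>f. f i) P"
        unfolding map_pmf_comp by (intro map_pmf_cong) (auto simp: d)
      also have "\<dots> = bernoulli_pmf ?p"
        using i by (simp add: P_def Pi_pmf_component)
      also have "\<dots> = map_pmf (\<lambda>r. r = real i) (pmf_of_set A)"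
        using map_pmf_of_set_eq_bernoulli[of A "real i"] A i by (simp add: A_def)
      finally show ?thesis
        unfolding M_def N_def X_def Y_def by (subst (1 2) distr_measure_pmf_compose) simp
    qed
    have "Lq_norm M q (\<lambda>\<omega>. \<Sum>i<m. X i \<omega>)
        = (let I = (\<integral>\<^sup>+r. ennreal (real (card {i\<in>{..<m}. d r i}) powr q) \<partial>map_pmf e P)
           in if I = \<infinity> then \<infinity> else ennreal (enn2real I powr (1 / q)))"
      by (simp add: Lq_norm_def M_def X_def sum.inter_filter[symmetric] of_bool_def)
    also have "(\<integral>\<^sup>+r. ennreal (real (card {i\<in>{..<m}. d r i}) powr q) \<partial>map_pmf e P)
        = (\<integral>\<^sup>+k. ennreal (real k powr q) \<partial>map_pmf (\<lambda>r. card {i\<in>{..<m}. d r i}) (map_pmf e P))"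
      by simp
    also have "map_pmf (\<lambda>r. card {i\<in>{..<m}. d r i}) (map_pmf e P) = map_pmf (\<lambda>f. card {i\<in>{..<m}. f i}) P"
      unfolding map_pmf_comp by (intro map_pmf_cong) (auto simp: d)
    also have "\<dots> = binomial_pmf m ?p"
      unfolding P_def by (rule binomial_pmf_altdef'[symmetric]) (use m in auto)
    also have "(\<integral>\<^sup>+k. ennreal (real k powr q) \<partial>binomial_pmf m ?p) = ennreal (binomial_moment q m)"
      by (rule nn_integral_binomial_powr[OF m])
    finally show "Lq_norm M q (\<lambda>\<omega>. \<Sum>i<m. X i \<omega>) = ennreal (binomial_moment q m powr (1 / q))"
      using m by (simp add: binomial_moment_def sum_nonneg)
    have "(\<Sum>i<m. Y i r) = 1" if r: "r \<in> A" for r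
    proof -
      obtain j where "j < m" "r = real j" using r by (auto simp: A_def)
      then show ?thesis by (simp add: Y_def of_bool_def)
    qed
    then have "AE r in N. ennreal (\<bar>\<Sum>i<m. Y i r\<bar> powr q) = 1"
      unfolding N_def AE_measure_pmf_iff using A by simp
    then have "(\<integral>\<^sup>+r. ennreal (\<bar>\<Sum>i<m. Y i r\<bar> powr q) \<partial>N) = (\<integral>\<^sup>+r. 1 \<partial>N)"
      by (rule nn_integral_cong_AE)
    also have "\<dots> = 1" by (simp add: N_def)
    finally show "Lq_norm N q (\<lambda>\<omega>. \<Sum>i<m. Y i \<omega>) = 1"
      by (simp add: Lq_norm_def)
  qed
qed

theorem theorem2:
  fixes q :: real
  assumes q: "q \<ge> 1"
  shows
    "(\<forall>(n::nat) (M::'a measure) (N::'b measure) X Y.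
        prob_space M \<and> prob_space N \<and>
        (\<forall>i<n. X i \<in> borel_measurable M \<and> Y i \<in> borel_measurable N) \<and>
        (\<forall>i<n. AE \<omega> in N. Y i \<omega> \<ge> 0) \<and>
        prob_space.indep_vars M (\<lambda>_. borel) X {..<n} \<and>
        (\<forall>i<n. distr M borel (X i) = distr N borel (Y i))
      \<longrightarrow> Lq_norm M q (\<lambda>\<omega>. \<Sum>i<n. X i \<omega>)
            \<le> ennreal (frac_bell q powr (1 / q)) * Lq_norm N q (\<lambda>\<omega>. \<Sum>i<n. Y i \<omega>))
   \<and>
    (\<forall>C::real. C < frac_bell q powr (1 / q) \<longrightarrow>
      (\<exists>(n::nat) (M::real measure) (N::real measure) X Y.
        prob_space M \<and> prob_space N \<and>
        (\<forall>i<n. X i \<in> borel_measurable M \<and> Y i \<in> borel_measurable N) \<and>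
        (\<forall>i<n. AE \<omega> in N. Y i \<omega> \<ge> 0) \<and>
        prob_space.indep_vars M (\<lambda>_. borel) X {..<n} \<and>
        (\<forall>i<n. distr M borel (X i) = distr N borel (Y i)) \<and>
        \<not> (Lq_norm M q (\<lambda>\<omega>. \<Sum>i<n. X i \<omega>)
              \<le> ennreal C * Lq_norm N q (\<lambda>\<omega>. \<Sum>i<n. Y i \<omega>))))"
proof ((rule conjI; intro allI impI), goal_cases)
  case (1 n M N X Y)
  then have h: "prob_space M" "prob_space N"
    "\<And>i. i < n \<Longrightarrow> X i \<in> borel_measurable M" "\<And>i. i < n \<Longrightarrow> Y i \<in> borel_measurable N"
    "\<And>i. i < n \<Longrightarrow> AE \<omega> in N. 0 \<le> Y i \<omega>"
    "prob_space.indep_vars M (\<lambda>_. borel) X {..<n}"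
    "\<And>i. i < n \<Longrightarrow> distr M borel (X i) = distr N borel (Y i)"
    by blast+
  have "(\<integral>\<^sup>+\<omega>. ennreal (\<bar>\<Sum>i<n. X i \<omega>\<bar> powr q) \<partial>M)
      \<le> ennreal (frac_bell q) * (\<integral>\<^sup>+\<omega>. ennreal (\<bar>\<Sum>i<n. Y i \<omega>\<bar> powr q) \<partial>N)"
    by (rule moment_decoupling[OF q h])
  then show ?case by (rule Lq_norm_le[OF q frac_bell_pos])
next
  case (2 C)
  have "(\<lambda>m. binomial_moment q m powr (1 / q)) \<longlonglongrightarrow> frac_bell q powr (1 / q)"
    using frac_bell_pos[of q] by (intro tendsto_powr binomial_moment_tendsto tendsto_const) auto
  then have "eventually (\<lambda>m. C < binomial_moment q m powr (1 / q)) sequentially"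
    using 2 by (rule order_tendstoD(1))
  \<comment> \<open>For negative \<open>C\<close> the value \<open>ennreal C\<close> is 0, so
    strictness in \<open>ennreal\<close> also needs a positive moment.\<close>
  moreover have "eventually (\<lambda>m. 0 < binomial_moment q m) sequentially"
    by (rule order_tendstoD(1)[OF binomial_moment_tendsto frac_bell_pos])
  ultimately have "eventually (\<lambda>m. m > 0 \<and> 0 < binomial_moment q m
      \<and> C < binomial_moment q m powr (1 / q)) sequentially"
    using eventually_gt_at_top[of "0::nat"] by eventually_elim simp
  from eventually_happens'[OF sequentially_bot this]
  obtain m where m: "m > 0" "0 < binomial_moment q m" "C < binomial_moment q m powr (1 / q)"
    by (elim exE conjE)
  obtain M N :: "real measure" and X Y :: "nat \<Rightarrow> real \<Rightarrow> real" where ex: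
    "prob_space M" "prob_space N"
    "\<And>i. i < m \<Longrightarrow> X i \<in> borel_measurable M" "\<And>i. i < m \<Longrightarrow> Y i \<in> borel_measurable N"
    "\<And>i. i < m \<Longrightarrow> AE \<omega> in N. 0 \<le> Y i \<omega>"
    "prob_space.indep_vars M (\<lambda>_. borel) X {..<m}"
    "\<And>i. i < m \<Longrightarrow> distr M borel (X i) = distr N borel (Y i)"
    "Lq_norm M q (\<lambda>\<omega>. \<Sum>i<m. X i \<omega>) = ennreal (binomial_moment q m powr (1 / q))"
    "Lq_norm N q (\<lambda>\<omega>. \<Sum>i<m. Y i \<omega>) = 1"
    by (rule partition_indicators_example[OF m(1), where q = q]) (rule that; assumption)
  have "ennreal C < ennreal (binomial_moment q m powr (1 / q))"
    using m by (intro ennreal_lessI) auto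
  then have less: "\<not> Lq_norm M q (\<lambda>\<omega>. \<Sum>i<m. X i \<omega>) \<le> ennreal C * Lq_norm N q (\<lambda>\<omega>. \<Sum>i<m. Y i \<omega>)"
    by (simp add: ex(8,9) not_le)
  show ?case
    by (rule exI[of _ m], rule exI[of _ M], rule exI[of _ N], rule exI[of _ X], rule exI[of _ Y])
       (intro conjI allI impI ex(1-7) less; assumption)
qed

end
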